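(* Let $\beta$ be a Salem number with minimal polynomial $P(x) = x^6 + ax^5 + bx^4 + cx^3 + bx^2 + ax + 1$, where $a,b,c\in\mathbb{Z}$. Then $\beta \in P_{1,7} \cap C_{x^2+2x+1}$ (that is, $d_\beta(1)$ is eventually periodic with preperiod length $1$ and period length $7$, and the co-factor of $\beta$ is $x^2+2x+1$) if and only if all of the following hold: (i) $a \leq -4$; (ii) $2 - 2a \leq 2b \leq -3a - 2$; (iii) $a - 2b + 2 \leq 2c \leq -2a - 4b$.
   Context: A Salem number is a real algebraic integer $\beta>1$ whose other Galois conjugates all satisfy $|\alpha|\le 1$, with at least one satisfying $|\alpha|=1$. For real $\beta>1$, the greedy beta expansion $d_\beta(1)=(c_n)_{n\ge1}$ is defined by $r_0=1$, and for $n\ge 1$: $c_n=\lfloor \beta r_{n-1}\rfloor$, $r_n=\beta r_{n-1}-\lfloor \beta r_{n-1}\rfloor$. If it is eventually periodic, $\beta$ is called a Parry number, and the smallest $m\ge0$ and $p\ge1$ with $c_{n+m}=c_{n+m+p}$ for all $n\ge1$ are the preperiod length and the period length of the expansion. (By convention $p=0$ if $r_N=0$ for some $N$; this never happens for Salem numbers.) For a Salem number $\beta$ that is a Parry number with preperiod length $m$ and period length $p\geq 1$, put $P_k(x)=x^k-c_1x^{k-1}-\dots-c_k$. The companion polynomial is $R(x)=P_{m+p}(x)-P_m(x)$; it has $\beta$ as a root, so $R(x)=P(x)Q(x)$ with $P$ the minimal polynomial of $\beta$ and $Q\in\mathbb{Z}[x]$; $Q$ is the co-factor of $\beta$. $P_{m,p}$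 denotes the set of Salem Parry numbers whose beta expansion $d_\beta(1)$ has preperiod length $m$ and period length $p$. $C_{Q(x)}$ denotes the set of all Salem (Parry) numbers whose co-factor is $Q(x)$. *)

theory Defs
  imports "HOL-Computational_Algebra.Computational_Algebra"
begin

definition is_min_poly :: "rat poly \<Rightarrow> real \<Rightarrow> bool" where
  "is_min_poly P \<beta> \<longleftrightarrow>
     lead_coeff P = 1 \<and> poly (map_poly of_rat P) \<beta> = 0 \<and>
     (\<forall>q. q \<noteq> 0 \<and> poly (map_poly of_rat q) \<beta> = 0 \<longrightarrow> degree P \<le> degree q)"

definition galois_conjugates :: "real \<Rightarrow> complex set" where
  "galois_conjugates \<beta> =
     {z. \<exists>P. is_min_poly P \<beta> \<and> poly (map_poly of_rat P) z = 0}"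

definition salem_number :: "real \<Rightarrow> bool" where
  "salem_number \<beta> \<longleftrightarrow>
     algebraic_int \<beta> \<and> \<beta> > 1 \<and>
     (\<forall>z \<in> galois_conjugates \<beta> - {of_real \<beta>}. cmod z \<le> 1) \<and>
     (\<exists>z \<in> galois_conjugates \<beta> - {of_real \<beta>}. cmod z = 1)"

fun beta_remainder :: "real \<Rightarrow> nat \<Rightarrow> real" where
  "beta_remainder \<beta> 0 = 1"
| "beta_remainder \<beta> (Suc n) =
     \<beta> * beta_remainder \<beta> n - of_int \<lfloor>\<beta> * beta_remainder \<beta> n\<rfloor>"

(* Only the indices n >= 1 are meaningful; the value at 0 is a by-product of
   truncated subtraction and is never used. *)
definition beta_digit :: "real \<Rightarrow> nat \<Rightarrow> int" where
  "beta_digit \<beta> n = \<lfloor>\<beta> * beta_remainder \<beta> (n - 1)\<rfloor>"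

definition digits_periodic :: "real \<Rightarrow> nat \<Rightarrow> nat \<Rightarrow> bool" where
  "digits_periodic \<beta> m p \<longleftrightarrow>
     (\<forall>n\<ge>1. beta_digit \<beta> (n + m) = beta_digit \<beta> (n + m + p))"

definition parry_number :: "real \<Rightarrow> bool" where
  "parry_number \<beta> \<longleftrightarrow> \<beta> > 1 \<and> (\<exists>m. \<exists>p\<ge>1. digits_periodic \<beta> m p)"

(* An eventually periodic sequence has a preperiod and a period that are
   simultaneously minimal, so minimizing m first and then p is no restriction. *)
definition preperiod_length :: "real \<Rightarrow> nat" where
  "preperiod_length \<beta> = (LEAST m. \<exists>p\<ge>1. digits_periodic \<beta> m p)"

definition period_length :: "real \<Rightarrow> nat" where
  "period_length \<beta> =
     (if \<exists>N. beta_remainder \<beta> N = 0 then 0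
      else LEAST p. p \<ge> 1 \<and> digits_periodic \<beta> (preperiod_length \<beta>) p)"

definition beta_poly :: "real \<Rightarrow> nat \<Rightarrow> int poly" where
  "beta_poly \<beta> k = monom 1 k - (\<Sum>i=1..k. monom (beta_digit \<beta> i) (k - i))"

definition companion_poly :: "real \<Rightarrow> int poly" where
  "companion_poly \<beta> =
     beta_poly \<beta> (preperiod_length \<beta> + period_length \<beta>) - beta_poly \<beta> (preperiod_length \<beta>)"

definition is_cofactor :: "int poly \<Rightarrow> real \<Rightarrow> bool" where
  "is_cofactor Q \<beta> \<longleftrightarrow>
     (\<exists>P :: int poly. is_min_poly (map_poly of_int P) \<beta> \<and> companion_poly \<beta> = P * Q)"

definition salem_parry_set :: "nat \<Rightarrow> nat \<Rightarrow> real set" where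
  "salem_parry_set m p =
     {\<beta>. salem_number \<beta> \<and> parry_number \<beta> \<and> preperiod_length \<beta> = m \<and> period_length \<beta> = p}"

definition cofactor_set :: "int poly \<Rightarrow> real set" where
  "cofactor_set Q = {\<beta>. salem_number \<beta> \<and> parry_number \<beta> \<and> is_cofactor Q \<beta>}"

end

(* Comparing coefficients in R = (x + 1)^2 P forces the digits of the expansion to be
   t, then the period u, v, w, v, u, t - 1, t - 1, with t = -a-2, u = -b-2a-1, v = -c-2b-a and
   w = -2b-2c = 2(v - u + t + 1).  Conditions (i)-(iii) amount to u \<le> t, v \<ge> 0 and w \<le> t,
   which hold for greedy digits because these lie between 0 and the first one.  Conversely, these
   inequalities make every shift of the digit sequence lexicographically smaller than the sequence,
   with a difference among the first two digits, so that by Parry's argument it is the greedy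
   expansion. *)
theory Submission
  imports Defs
begin

section \<open>Minimal polynomials\<close>

lemma map_poly_of_rat_diff:
  "map_poly (of_rat :: rat \<Rightarrow> real) (P - Q) = map_poly of_rat P - map_poly of_rat Q"
  by (simp add: poly_eq_iff coeff_map_poly of_rat_diff)

text \<open>Two monic annihilators of the same minimal degree have a difference of smaller degree
  that still vanishes at \<open>x\<close>, so it is zero. This identifies the polynomial hidden in
  \<open>is_cofactor\<close> with the given sextic.\<close>

lemma is_min_poly_unique:
  assumes "is_min_poly P x" "is_min_poly Q x"
  shows "P = Q"
proof (rule ccontr)
  assume "P \<noteq> Q"
  have nz: "P \<noteq> 0" "Q \<noteq> 0"
    using assms by (auto simp: is_min_poly_def)
  have deg: "degree P = degree Q"
    using assms nz by (intro antisym) (auto simp: is_min_poly_def)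
  have "poly (map_poly of_rat (P - Q)) x = 0"
    using assms by (simp add: is_min_poly_def map_poly_of_rat_diff)
  with \<open>P \<noteq> Q\<close> assms(1) have le: "degree P \<le> degree (P - Q)"
    by (simp add: is_min_poly_def)
  have "coeff (P - Q) (degree P) = 0"
    using assms deg by (simp add: is_min_poly_def)
  moreover have "degree (P - Q) \<le> degree P"
    using deg degree_diff_le_max[of P Q] by simp
  ultimately have "lead_coeff (P - Q) = 0"
    using le by (metis antisym)
  with \<open>P \<noteq> Q\<close> show False
    unfolding leading_coeff_0_iff by simp
qed

lemma map_poly_of_int_eq_iff:
  "map_poly (of_int :: int \<Rightarrow> 'a::ring_char_0) P = map_poly of_int Q \<longleftrightarrow> P = Q"
  by (auto simp: poly_eq_iff coeff_map_poly)

section \<open>Beta expansions\<close>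

lemma beta_remainder_bounds:
  "0 \<le> beta_remainder \<beta> n \<and> beta_remainder \<beta> n \<le> 1"
  by (cases n) (auto, linarith+)

lemma beta_digit_bounds:
  assumes "0 \<le> \<beta>"
  shows "0 \<le> beta_digit \<beta> n" "beta_digit \<beta> n \<le> beta_digit \<beta> 1"
proof -
  have "\<beta> * beta_remainder \<beta> k \<le> \<beta>" for k
    using assms beta_remainder_bounds[of \<beta> k] by (simp add: mult_left_le)
  then show "0 \<le> beta_digit \<beta> n" "beta_digit \<beta> n \<le> beta_digit \<beta> 1"
    using assms beta_remainder_bounds by (auto simp: beta_digit_def intro: floor_mono)
qed

lemma digits_periodicD:
  "digits_periodic \<beta> m p \<Longrightarrow> 1 \<le> n \<Longrightarrow> beta_digit \<beta> (n + m + p) = beta_digit \<beta> (n + m)"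
  by (simp only: digits_periodic_def)

text \<open>Passing to a multiple of a hypothetical period allows it to be compared with the known
  block length 7.\<close>

lemma digits_periodic_mult:
  assumes "digits_periodic \<beta> m p"
  shows "digits_periodic \<beta> m (k * p)"
proof (induction k)
  case 0
  show ?case by (simp add: digits_periodic_def)
next
  case (Suc k)
  show ?case unfolding digits_periodic_def
  proof (intro allI impI)
    fix n :: nat assume n: "n \<ge> 1"
    have "beta_digit \<beta> (n + m) = beta_digit \<beta> (n + m + k * p)"
      using Suc n by (simp add: digits_periodic_def)
    also have "\<dots> = beta_digit \<beta> ((n + k * p) + m)" by (simp add: ac_simps)
    also have "\<dots> = beta_digit \<beta> ((n + k * p) + m + p)"
      using assms n by (intro digits_periodicD[symmetric]) auto
    finally show "beta_digit \<beta> (n + m) = beta_digit \<beta> (n + m + Suc k * p)"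
      by (simp add: ac_simps)
  qed
qed

text \<open>The remainders that \<open>d\<close> would produce if it were greedy. Without floors,
  the n-th one is the value at \<beta> of x^n - d_1 x^(n-1) - ... - d_n; \<open>d 0\<close> never
  enters.\<close>

primrec expansion_remainder :: "real \<Rightarrow> (nat \<Rightarrow> int) \<Rightarrow> nat \<Rightarrow> real" where
  "expansion_remainder \<beta> d 0 = 1"
| "expansion_remainder \<beta> d (Suc n) = \<beta> * expansion_remainder \<beta> d n - of_int (d (Suc n))"

lemma beta_remainder_eqI:
  assumes "\<And>n. 0 \<le> expansion_remainder \<beta> d (Suc n)"
    and "\<And>n. expansion_remainder \<beta> d (Suc n) < 1"
  shows "beta_remainder \<beta> n = expansion_remainder \<beta> d n"
    and "beta_digit \<beta> (Suc n) = d (Suc n)"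
proof -
  have fl: "\<lfloor>\<beta> * expansion_remainder \<beta> d k\<rfloor> = d (Suc k)" for k
    using assms[of k] by (simp add: floor_eq_iff)
  show *: "beta_remainder \<beta> n = expansion_remainder \<beta> d n" for n
    by (induction n) (simp_all add: fl)
  show "beta_digit \<beta> (Suc n) = d (Suc n)"
    by (simp add: beta_digit_def * fl)
qed

text \<open>Finiteness provides a smallest remainder. Its successor is no smaller, yet at most
  \<beta> times it; since \<beta> > 1, the minimum cannot be negative.\<close>

lemma expansion_remainder_nonneg:
  assumes "\<beta> > 1" and fin: "finite (range (expansion_remainder \<beta> d))"
    and d: "\<And>n. 0 \<le> d (Suc n)"
  shows "0 \<le> expansion_remainder \<beta> d n"
proof -
  let ?s = "expansion_remainder \<beta> d"
  have "Min (range ?s) \<in> range ?s" using fin by (intro Min_in) auto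
  then obtain k where k: "Min (range ?s) = ?s k" by auto
  have min: "?s k \<le> ?s j" for j using fin by (simp flip: k)
  have "0 \<le> real_of_int (d (Suc k))" using d by simp
  then have "?s k \<le> \<beta> * ?s k"
    using min[of "Suc k"] by simp
  then have "0 \<le> ?s k" using \<open>\<beta> > 1\<close>
    by (simp add: mult_le_cancel_right1)
  then show ?thesis using min[of n] by linarith
qed

text \<open>After a zero remainder comes minus a digit, which nonnegativity forces to be 0; so all
  later digits would vanish.\<close>

lemma expansion_remainder_pos:
  assumes "\<beta> > 1" and fin: "finite (range (expansion_remainder \<beta> d))"
    and d: "\<And>n. 0 \<le> d (Suc n)" and inf: "\<And>n. \<exists>k\<ge>n. 0 < d (Suc k)"
  shows "0 < expansion_remainder \<beta> d n"
proof (rule ccontr)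
  let ?s = "expansion_remainder \<beta> d"
  note nonneg = expansion_remainder_nonneg[OF assms(1-3)]
  assume "\<not> 0 < ?s n"
  then have n: "?s n = 0" using nonneg[of n] by simp
  have step: "?s (Suc k) = 0 \<and> d (Suc k) = 0" if "?s k = 0" for k
    using nonneg[of "Suc k"] d[of k] that by simp
  have "?s k = 0" if "k \<ge> n" for k
    using that by (induction k rule: dec_induct) (use n step in blast)+
  with step inf[of n] show False by force
qed

text \<open>Parry's admissibility criterion, when the lexicographic comparison is already decided
  by the first two digits. At an index where the remainder is largest, a remainder of at least 1
  would contradict the comparison with \<open>\<beta> = d 1 + s 1\<close>.\<close>

lemma expansion_remainder_less_1:
  assumes "\<beta> > 1" and fin: "finite (range (expansion_remainder \<beta> d))"
    and d: "\<And>n. 0 \<le> d (Suc n)" and inf: "\<And>n. \<exists>k\<ge>n. 0 < d (Suc k)"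
    and lex: "\<And>n. d (n + 2) < d 1 \<or> d (n + 2) = d 1 \<and> d (n + 3) < d 2"
  shows "expansion_remainder \<beta> d (Suc n) < 1"
proof -
  let ?s = "expansion_remainder \<beta> d"
  note pos = expansion_remainder_pos[OF assms(1-4)]
  \<comment> \<open>Index 0 is left out of the maximum, because the remainder there is 1.\<close>
  let ?A = "range (\<lambda>j. ?s (Suc j))"
  have finA: "finite ?A" by (rule finite_subset[OF _ fin]) blast
  then have "Max ?A \<in> ?A" by (intro Max_in) auto
  then obtain k where k: "Max ?A = ?s (Suc k)" by auto
  have max: "?s (Suc j) \<le> ?s (Suc k)" for j
    unfolding k[symmetric] using finA by (intro Max_ge) auto
  define M where "M = ?s (Suc k)"
  have s1: "?s 1 = \<beta> - d 1" and s2: "?s 2 = \<beta> * ?s 1 - d 2"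
    by (simp_all add: numeral_2_eq_2)
  have sk1: "?s (k + 2) = \<beta> * M - d (k + 2)" and sk2: "?s (k + 3) = \<beta> * ?s (k + 2) - d (k + 3)"
    by (simp_all add: M_def numeral_eq_Suc)
  have le: "?s (k + 2) \<le> M" "?s (k + 3) \<le> M"
    using max[of "k + 1"] max[of "k + 2"] by (simp_all add: M_def numeral_eq_Suc)
  have "M < 1"
  proof (rule ccontr)
    assume "\<not> M < 1"
    then have M: "M - 1 \<ge> 0" by simp
    have mono: "M - 1 \<le> \<beta> * (M - 1)"
      using mult_right_mono[OF less_imp_le[OF \<open>\<beta> > 1\<close>] M] by simp
    show False
      using lex[of k]
    proof (elim disjE conjE)
      assume "d (k + 2) < d 1"
      then have "d (k + 2) - d 1 \<le> -1" by simp
      then have "real_of_int (d (k + 2)) - of_int (d 1) \<le> -1"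
        by linarith
      \<comment> \<open>Here \<open>?s (k + 2) - ?s 1\<close> is at least \<beta> (M - 1) + 1, hence
        at least M; as \<open>?s 1\<close> is positive, the maximum is exceeded.\<close>
      then show False
        using mono le pos[of 1] s1 sk1 by (simp add: algebra_simps)
    next
      assume eq: "d (k + 2) = d 1" and "d (k + 3) < d 2"
      then have "real_of_int (d (k + 3)) - of_int (d 2) \<le> -1"
        by linarith
      \<comment> \<open>With equal first digits, the gap M - 1 is multiplied by \<beta> twice before
        the second digits differ, so now \<open>?s (k + 3)\<close> exceeds M.\<close>
      moreover have "\<beta> * (\<beta> * (M - 1)) = ?s (k + 3) - ?s 2 + d (k + 3) - d 2"
        unfolding sk2 s2 sk1 s1 eq by (simp add: algebra_simps)
      moreover have "\<beta> * (M - 1) \<le> \<beta> * (\<beta> * (M - 1))"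
        using mono \<open>\<beta> > 1\<close> by simp
      ultimately show False
        using mono le pos[of 2] by linarith
    qed
  qed
  then show ?thesis using max[of n] by (simp add: M_def)
qed

section \<open>The period of length seven\<close>

text \<open>The repeating block starts at digit 2, hence the shift by 2; the value at 0 is a
  dummy.\<close>

definition period7_digits :: "int \<Rightarrow> int \<Rightarrow> int \<Rightarrow> int \<Rightarrow> nat \<Rightarrow> int" where
  "period7_digits t u v w n =
     (if n \<le> 1 then t else [u, v, w, v, u, t - 1, t - 1] ! ((n - 2) mod 7))"

lemma mod_7_cases: "n mod 7 \<in> {0, 1, 2, 3, 4, 5, 6 :: nat}"
proof -
  have "n mod 7 < 7" by simp
  then show ?thesis unfolding insert_iff by linarith
qed

text \<open>The assumed equation is the companion polynomial P_8 - P_1 at \<beta>, so it says that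
  remainders 8 and 1 agree. Equal digits then propagate this. Subtracting P_1 turns the last two
  digits t - 1 into the coefficients -t and 1.\<close>

lemma period7_remainder_add_7:
  assumes "\<beta> ^ 8 - t * \<beta> ^ 7 - u * \<beta> ^ 6 - v * \<beta> ^ 5 - w * \<beta> ^ 4 - v * \<beta> ^ 3 - u * \<beta> ^ 2
    - t * \<beta> + 1 = 0"
  shows "expansion_remainder \<beta> (period7_digits t u v w) (Suc n + 7) =
         expansion_remainder \<beta> (period7_digits t u v w) (Suc n)"
proof (induction n)
  case 0
  let ?d = "period7_digits t u v w"
  let ?s = "expansion_remainder \<beta> ?d"
  have step: "?s (n + 1) = \<beta> * ?s n - ?d (n + 1)" for n by simp
  have s1: "?s 1 = \<beta> - t" by (simp add: period7_digits_def)
  have s8: "?s 8 = \<beta> * (\<beta> * (\<beta> * (\<beta> * (\<beta> * (\<beta> * (\<beta> * ?s 1 - u) - v) - w) - v) - u)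
      - (t - 1)) - (t - 1)"
    using step[of 1] step[of 2] step[of 3] step[of 4] step[of 5] step[of 6] step[of 7]
    by (simp add: period7_digits_def flip: numeral_2_eq_2 del: expansion_remainder.simps)
  have "?s 8 - ?s 1 = 0"
    using assms unfolding s8 s1 of_int_diff of_int_1 by algebra
  then show ?case by simp
next
  case (Suc n)
  let ?d = "period7_digits t u v w"
  let ?s = "expansion_remainder \<beta> ?d"
  have "?s (Suc (Suc n) + 7) = \<beta> * ?s (Suc n + 7) - ?d (Suc (Suc n) + 7)"
    by (simp only: add_Suc expansion_remainder.simps)
  also have "?d (Suc (Suc n) + 7) = ?d (Suc (Suc n))"
    by (simp add: period7_digits_def)
  finally show ?case
    by (simp only: Suc expansion_remainder.simps)
qed

text \<open>The equation for \<open>w\<close> says that -1 is a root of the companion polynomial; it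
  yields the strict inequalities needed for the lexicographic comparison.\<close>

lemma period7_expansion:
  fixes \<beta> :: real and t u v w :: int
  assumes "\<beta> > 1" and "u \<le> t" and "0 \<le> v" and "w \<le> t" and w: "w = 2 * (v - u + t + 1)"
    and root: "\<beta> ^ 8 - t * \<beta> ^ 7 - u * \<beta> ^ 6 - v * \<beta> ^ 5 - w * \<beta> ^ 4 - v * \<beta> ^ 3 - u * \<beta> ^ 2
      - t * \<beta> + 1 = 0"
  shows "beta_digit \<beta> (Suc n) = period7_digits t u v w (Suc n)"
    and "0 < beta_remainder \<beta> n"
proof -
  let ?d = "period7_digits t u v w"
  let ?s = "expansion_remainder \<beta> ?d"
  \<comment> \<open>From \<open>u \<le> t\<close> and \<open>0 \<le> v\<close> follows w \<ge> 2, so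
    t \<ge> 2; then \<open>w \<le> t\<close> gives 2 (u - v) \<ge> t + 2 > 0.\<close>
  have ineqs: "v < u" "v < t" "2 \<le> w" "t \<ge> 2"
    using assms(2-5) by auto
  have per: "?s (Suc n + 7) = ?s (Suc n)" for n
    by (rule period7_remainder_add_7[OF root])
  have "?s n \<in> ?s ` {..7}" for n
  proof (induction n rule: less_induct)
    case (less n)
    show ?case
    proof (cases "n \<le> 7")
      case False
      then obtain j where "n = Suc j + 7"
        using le_Suc_ex[of 8 n] by auto
      then have "?s n = ?s (n - 7)" using per[of j] by (simp del: expansion_remainder.simps)
      with less[of "n - 7"] False show ?thesis by simp
    qed auto
  qed
  then have fin: "finite (range ?s)"
    by (meson finite_atMost finite_imageI finite_subset image_subsetI)
  have d: "0 \<le> ?d (Suc n)" for n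
    using mod_7_cases[of "Suc n - 2"] assms(3) ineqs
    by (auto simp: period7_digits_def)
  have inf: "\<exists>k\<ge>n. 0 < ?d (Suc k)" for n
    \<comment> \<open>This index hits the first entry of a block, and u > v \<ge> 0.\<close>
    by (rule exI[of _ "7 * n + 1"]) (use assms(3) ineqs in \<open>simp add: period7_digits_def\<close>)
  \<comment> \<open>A tie with the leading t can occur only at u or w. The next digit is then v < u,
    or t - 1 after the second u, where u = t.\<close>
  have lex: "?d (n + 2) < ?d 1 \<or> ?d (n + 2) = ?d 1 \<and> ?d (n + 3) < ?d 2" for n
  proof -
    define r where "r = n mod 7"
    have "?d (n + 2) = [u, v, w, v, u, t - 1, t - 1] ! r" "?d 1 = t" "?d 2 = u"
      "?d (n + 3) = [u, v, w, v, u, t - 1, t - 1] ! ((r + 1) mod 7)"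
      by (simp_all add: period7_digits_def r_def mod_Suc_eq)
    moreover have "r \<in> {0, 1, 2, 3, 4, 5, 6}"
      unfolding r_def by (rule mod_7_cases)
    ultimately show ?thesis
      using assms(2,4) ineqs by (elim insertE emptyE) auto
  qed
  have bounds: "0 < ?s n" "?s (Suc n) < 1" for n
    using expansion_remainder_pos[OF assms(1) fin d inf]
      expansion_remainder_less_1[OF assms(1) fin d inf lex] by blast+
  show "beta_digit \<beta> (Suc n) = ?d (Suc n)"
    by (intro beta_remainder_eqI less_imp_le bounds)
  have "beta_remainder \<beta> n = ?s n"
    by (intro beta_remainder_eqI less_imp_le bounds)
  with bounds show "0 < beta_remainder \<beta> n" by simp
qed

lemma period7_lengths:
  assumes digit: "\<And>n. beta_digit \<beta> (Suc n) = period7_digits t u v w (Suc n)"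
    and "v \<noteq> u" and nz: "\<And>n. beta_remainder \<beta> n \<noteq> 0"
  shows "digits_periodic \<beta> 1 7" "preperiod_length \<beta> = 1" "period_length \<beta> = 7"
proof -
  have val: "beta_digit \<beta> (n + 2) = [u, v, w, v, u, t - 1, t - 1] ! (n mod 7)" for n
    using digit[of "n + 1"] by (simp add: period7_digits_def)
  show per: "digits_periodic \<beta> 1 7"
    unfolding digits_periodic_def
  proof (intro allI impI)
    fix n :: nat assume "n \<ge> 1"
    then obtain j where "n = Suc j" by (cases n) auto
    then show "beta_digit \<beta> (n + 1) = beta_digit \<beta> (n + 1 + 7)"
      using val[of j] val[of "j + 7"] by simp
  qed
  \<comment> \<open>Digit 1 is t, while digit 1 + 7p closes a block and is t - 1.\<close>
  have no0: "\<not> digits_periodic \<beta> 0 p" if "p \<ge> 1" for p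
  proof
    assume "digits_periodic \<beta> 0 p"
    then have "beta_digit \<beta> 1 = beta_digit \<beta> (1 + 7 * p)"
      using digits_periodicD[OF digits_periodic_mult[of \<beta> 0 p 7], of 1] by simp
    also have "1 + 7 * p = (6 + 7 * (p - 1)) + 2" using that by simp
    also have "beta_digit \<beta> \<dots> = t - 1" by (subst val) simp
    finally show False using digit[of 0] by (simp add: period7_digits_def)
  qed
  show pre: "preperiod_length \<beta> = 1"
    unfolding preperiod_length_def
  proof (rule Least_equality)
    show "\<exists>p\<ge>1. digits_periodic \<beta> 1 p" using per by (intro exI[of _ 7]) auto
    show "1 \<le> m" if "\<exists>p\<ge>1. digits_periodic \<beta> m p" for m
      using that no0 by (cases m) auto
  qed
  have min: "7 \<le> p" if "p \<ge> 1" "digits_periodic \<beta> 1 p" for p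
  proof (rule ccontr)
    assume "\<not> 7 \<le> p"
    then have "p \<in> {1, 2, 3, 4, 5, 6}" using that by auto
    \<comment> \<open>\<open>k\<close> is the inverse of p modulo 7. The multiple k p shifts the
      block by one place, which would force u = v.\<close>
    then obtain k where k: "k * p mod 7 = 1"
      by (elim insertE emptyE)
        (rule that[of 1] that[of 4] that[of 5] that[of 2] that[of 3] that[of 6]; simp)+
    have "beta_digit \<beta> (0 + 2) = beta_digit \<beta> (k * p + 2)"
      using digits_periodicD[OF digits_periodic_mult[OF that(2), of k], of 1]
      by (simp add: numeral_2_eq_2)
    then show False using k \<open>v \<noteq> u\<close> unfolding val by simp
  qed
  show "period_length \<beta> = 7"
    unfolding period_length_def pre using nz per min by (auto intro: Least_equality)
qed

section \<open>The co-factor\<close>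

lemma companion_poly_1_7:
  assumes "preperiod_length \<beta> = 1" "period_length \<beta> = 7"
  shows "companion_poly \<beta> =
    [:beta_digit \<beta> 1 - beta_digit \<beta> 8, - 1 - beta_digit \<beta> 7, - beta_digit \<beta> 6, - beta_digit \<beta> 5,
      - beta_digit \<beta> 4, - beta_digit \<beta> 3, - beta_digit \<beta> 2, - beta_digit \<beta> 1, 1:]"
  using assms
  by (simp add: companion_poly_def beta_poly_def eval_nat_numeral monom_Suc monom_0
      sum.atLeast_Suc_atMost)

lemma mult_cofactor:
  fixes a b c :: int
  shows "[:1, a, b, c, b, a, 1:] * [:1, 2, 1:] =
    [:1, a + 2, b + 2 * a + 1, c + 2 * b + a, 2 * b + 2 * c, c + 2 * b + a, b + 2 * a + 1, a + 2, 1:]"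
  by simp

theorem proposition2p5:
  fixes \<beta> :: real and a b c :: int
  assumes "salem_number \<beta>"
    and "is_min_poly (map_poly of_int [:1, a, b, c, b, a, 1:]) \<beta>"
  shows "\<beta> \<in> salem_parry_set 1 7 \<inter> cofactor_set [:1, 2, 1:] \<longleftrightarrow>
    a \<le> -4 \<and>
    (2 - 2 * a \<le> 2 * b \<and> 2 * b \<le> - 3 * a - 2) \<and>
    (a - 2 * b + 2 \<le> 2 * c \<and> 2 * c \<le> - 2 * a - 4 * b)"
    (is "?L \<longleftrightarrow> ?R")
proof -
  have gt1: "\<beta> > 1" using assms(1) by (simp add: salem_number_def)
  show ?thesis
  proof
    assume ?L
    then have len: "preperiod_length \<beta> = 1" "period_length \<beta> = 7"
      and "is_cofactor [:1, 2, 1:] \<beta>"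
      by (auto simp: salem_parry_set_def cofactor_set_def)
    then obtain P :: "int poly" where "is_min_poly (map_poly of_int P) \<beta>"
      and comp: "companion_poly \<beta> = P * [:1, 2, 1:]"
      by (auto simp: is_cofactor_def)
    then have "P = [:1, a, b, c, b, a, 1:]"
      using is_min_poly_unique[OF _ assms(2)] map_poly_of_int_eq_iff by blast
    with comp have eq: "companion_poly \<beta> = [:1, a, b, c, b, a, 1:] * [:1, 2, 1:]"
      by simp
    have dig: "beta_digit \<beta> 1 = - a - 2" "beta_digit \<beta> 2 = - b - 2 * a - 1"
        "beta_digit \<beta> 3 = - c - 2 * b - a" "beta_digit \<beta> 4 = - 2 * b - 2 * c"
      using eq unfolding companion_poly_1_7[OF len] mult_cofactor by auto
    have "0 \<le> beta_digit \<beta> 3" "beta_digit \<beta> 4 \<le> beta_digit \<beta> 1" "beta_digit \<beta> 2 \<le> beta_digit \<beta> 1"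
      using gt1 by (auto intro!: beta_digit_bounds simp del: One_nat_def)
    moreover have "1 \<le> beta_digit \<beta> 1"
      using gt1 by (simp add: beta_digit_def le_floor_iff)
    \<comment> \<open>The digit bounds give the lower bound on 2b and both bounds on 2c. Chaining
      the latter two gives 2b \<le> -3a - 2, and chaining the two bounds on 2b gives a \<le>
      -4.\<close>
    ultimately show ?R unfolding dig by linarith
  next
    assume R: ?R
    define t u v w where "t = - a - 2" and "u = - b - 2 * a - 1" and "v = - c - 2 * b - a"
      and "w = - 2 * b - 2 * c"
    note defs = t_def u_def v_def w_def
    have conds: "u \<le> t" "0 \<le> v" "w \<le> t" "w = 2 * (v - u + t + 1)"
      using R by (auto simp: defs)
    then have "v \<noteq> u" by auto
    have root: "1 + a * \<beta> + b * \<beta> ^ 2 + c * \<beta> ^ 3 + b * \<beta> ^ 4 + a * \<beta> ^ 5 + \<beta> ^ 6 = 0"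
      using assms(2) by (simp add: is_min_poly_def map_poly_pCons eval_nat_numeral algebra_simps)
    \<comment> \<open>The factor (\<beta> + 1)^2 is the co-factor evaluated at \<beta>.\<close>
    have "\<beta> ^ 8 - t * \<beta> ^ 7 - u * \<beta> ^ 6 - v * \<beta> ^ 5 - w * \<beta> ^ 4 - v * \<beta> ^ 3 - u * \<beta> ^ 2 - t * \<beta> + 1
      = (1 + a * \<beta> + b * \<beta> ^ 2 + c * \<beta> ^ 3 + b * \<beta> ^ 4 + a * \<beta> ^ 5 + \<beta> ^ 6) * (\<beta> + 1) ^ 2"
      unfolding defs of_int_diff of_int_minus of_int_mult of_int_numeral of_int_1 by algebra
    with root have root': "\<beta> ^ 8 - t * \<beta> ^ 7 - u * \<beta> ^ 6 - v * \<beta> ^ 5 - w * \<beta> ^ 4 - v * \<beta> ^ 3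
      - u * \<beta> ^ 2 - t * \<beta> + 1 = 0" by simp
    note expansion = period7_expansion[OF gt1 conds root']
    \<comment> \<open>This rules out the convention that sets the period length to 0 when a
      remainder vanishes.\<close>
    have nz: "beta_remainder \<beta> n \<noteq> 0" for n using expansion(2)[of n] by simp
    note len = period7_lengths[OF expansion(1) \<open>v \<noteq> u\<close> nz]
    have "parry_number \<beta>"
      unfolding parry_number_def using gt1 len(1) by (intro conjI exI[of _ 1] exI[of _ 7]) auto
    moreover have "companion_poly \<beta> = [:1, a, b, c, b, a, 1:] * [:1, 2, 1:]"
      unfolding companion_poly_1_7[OF len(2,3)] mult_cofactor
      using expansion(1)[of 0] expansion(1)[of 1] expansion(1)[of 2] expansion(1)[of 3]
        expansion(1)[of 4] expansion(1)[of 5] expansion(1)[of 6] expansion(1)[of 7]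
      by (simp add: period7_digits_def defs flip: numeral_2_eq_2)
    ultimately show ?L
      using assms len unfolding salem_parry_set_def cofactor_set_def is_cofactor_def by blast
  qed
qed

end
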